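(* If $R$ is a unit-regular NI-ring and $G$ is a locally finite group, then the group ring $RG$ is strongly unit nil-clean.
   Context: Rings are associative with identity, not necessarily commutative. A ring $R$ is unit-regular if for every $a\in R$ there is a unit $u\in R$ with $a=aua$. $R$ is an NI-ring if the set $\mathrm{Nil}(R)$ of its nilpotent elements is an ideal. An element of a ring is strongly nil-clean if it is the sum of an idempotent $e$ and a nilpotent $b$ with $eb=be$. A ring $S$ is strongly unit nil-clean if for every $a\in S$ there is a unit $u\in S$ such that $ua$ is strongly nil-clean. A group is locally finite if each of its finitely generated subgroups is finite. *)

theory Defs
  imports "HOL-Algebra.Algebra"
begin

definition unit_regular :: "('a, 'm) ring_scheme \<Rightarrow> bool"
  where "unit_regular R \<longleftrightarrow>
    (\<forall>a\<in>carrier R. \<exists>u\<in>Units R. a = a \<otimes>\<^bsub>R\<^esub> u \<otimes>\<^bsub>R\<^esub> a)"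

definition nilpotents :: "('a, 'm) ring_scheme \<Rightarrow> 'a set"
  where "nilpotents R = {a \<in> carrier R. \<exists>n::nat. a [^]\<^bsub>R\<^esub> n = \<zero>\<^bsub>R\<^esub>}"

definition NI_ring :: "('a, 'm) ring_scheme \<Rightarrow> bool"
  where "NI_ring R \<longleftrightarrow> ideal (nilpotents R) R"

definition strongly_nil_clean :: "('a, 'm) ring_scheme \<Rightarrow> 'a \<Rightarrow> bool"
  where "strongly_nil_clean R a \<longleftrightarrow>
    (\<exists>e\<in>carrier R. \<exists>b\<in>nilpotents R.
      e \<otimes>\<^bsub>R\<^esub> e = e \<and> e \<otimes>\<^bsub>R\<^esub> b = b \<otimes>\<^bsub>R\<^esub> e \<and> a = e \<oplus>\<^bsub>R\<^esub> b)"

definition strongly_unit_nil_clean :: "('a, 'm) ring_scheme \<Rightarrow> bool"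
  where "strongly_unit_nil_clean R \<longleftrightarrow>
    (\<forall>a\<in>carrier R. \<exists>u\<in>Units R. strongly_nil_clean R (u \<otimes>\<^bsub>R\<^esub> a))"

definition locally_finite :: "('g, 'n) monoid_scheme \<Rightarrow> bool"
  where "locally_finite G \<longleftrightarrow>
    (\<forall>S. S \<subseteq> carrier G \<and> finite S \<longrightarrow> finite (generate G S))"

definition group_ring :: "('a, 'm) ring_scheme \<Rightarrow> ('g, 'n) monoid_scheme \<Rightarrow> ('g \<Rightarrow> 'a) ring"
  \<comment> \<open>A formal sum of elements \<open>f g \<cdot> g\<close> is represented by its coefficient function \<open>f\<close>, made
    extensional outside of \<open>carrier G\<close>; the product is convolution.\<close>
  where "group_ring R G =
    \<lparr> partial_object.carrier = {f \<in> carrier G \<rightarrow>\<^sub>E carrier R. finite {g \<in> carrier G. f g \<noteq> \<zero>\<^bsub>R\<^esub>}},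
      monoid.mult = (\<lambda>f h. \<lambda>g\<in>carrier G.
        \<Oplus>\<^bsub>R\<^esub>x\<in>{x \<in> carrier G. f x \<noteq> \<zero>\<^bsub>R\<^esub>}. f x \<otimes>\<^bsub>R\<^esub> h (inv\<^bsub>G\<^esub> x \<otimes>\<^bsub>G\<^esub> g)),
      monoid.one = (\<lambda>g\<in>carrier G. if g = \<one>\<^bsub>G\<^esub> then \<one>\<^bsub>R\<^esub> else \<zero>\<^bsub>R\<^esub>),
      ring.zero = (\<lambda>g\<in>carrier G. \<zero>\<^bsub>R\<^esub>),
      ring.add = (\<lambda>f h. \<lambda>g\<in>carrier G. f g \<oplus>\<^bsub>R\<^esub> h g) \<rparr>"

lemma (in abelian_monoid) finsum_exchange:
  assumes "finite A" "finite B" "\<And>x y. x \<in> A \<Longrightarrow> y \<in> B \<Longrightarrow> f x y \<in> carrier G"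
  shows "(\<Oplus>x\<in>A. \<Oplus>y\<in>B. f x y) = (\<Oplus>y\<in>B. \<Oplus>x\<in>A. f x y)"
  using assms(1,3)
proof (induction A rule: finite_induct)
  case empty
  then show ?case by (simp add: finsum_zero)
next
  case (insert a A)
  have "(\<Oplus>x\<in>insert a A. \<Oplus>y\<in>B. f x y) = (\<Oplus>y\<in>B. f a y) \<oplus> (\<Oplus>x\<in>A. \<Oplus>y\<in>B. f x y)"
    using insert by (intro finsum_insert) (auto intro!: finsum_closed)
  also have "\<dots> = (\<Oplus>y\<in>B. f a y) \<oplus> (\<Oplus>y\<in>B. \<Oplus>x\<in>A. f x y)"
    using insert by simp
  also have "\<dots> = (\<Oplus>y\<in>B. f a y \<oplus> (\<Oplus>x\<in>A. f x y))"
    using insert by (intro finsum_addf[symmetric]) (auto intro!: finsum_closed)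
  also have "\<dots> = (\<Oplus>y\<in>B. \<Oplus>x\<in>insert a A. f x y)"
    using insert by (intro finsum_cong' refl) (auto intro!: finsum_closed simp: finsum_insert)
  finally show ?case .
qed

lemma (in abelian_monoid) finsum_superset:
  assumes "finite B" "A \<subseteq> B" "\<And>x. x \<in> B \<Longrightarrow> f x \<in> carrier G"
    and "\<And>x. x \<in> B \<Longrightarrow> x \<notin> A \<Longrightarrow> f x = \<zero>"
  shows "finsum G f A = finsum G f B"
  using assms by (intro add.finprod_mono_neutral_cong_left) auto

lemma group_ring_ring:
  assumes "ring R" "group G"
  shows "ring (group_ring R G)"
proof -
  interpret R: ring R by fact
  interpret G: group G by fact
  let ?S = "group_ring R G"
  define supp where "supp f = {g \<in> carrier G. f g \<noteq> \<zero>\<^bsub>R\<^esub>}" for f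
  have car: "f \<in> carrier ?S \<longleftrightarrow> f \<in> carrier G \<rightarrow>\<^sub>E carrier R \<and> finite (supp f)" for f
    by (simp add: group_ring_def supp_def)
  have cl: "f g \<in> carrier R" if "f \<in> carrier ?S" "g \<in> carrier G" for f g
    using that by (auto simp: car)
  have fin: "finite (supp f)" if "f \<in> carrier ?S" for f
    using that by (simp add: car)
  have suppG: "supp f \<subseteq> carrier G" for f
    by (auto simp: supp_def)
  have ext: "f = h" if "f \<in> carrier ?S" "h \<in> carrier ?S" "\<And>g. g \<in> carrier G \<Longrightarrow> f g = h g" for f h
    using that by (intro PiE_ext[of f "carrier G" "\<lambda>_. carrier R"]) (auto simp: car)
  have zero_val: "\<zero>\<^bsub>?S\<^esub> g = \<zero>\<^bsub>R\<^esub>" if "g \<in> carrier G" for g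
    using that by (simp add: group_ring_def)
  have one_val: "\<one>\<^bsub>?S\<^esub> g = (if g = \<one>\<^bsub>G\<^esub> then \<one>\<^bsub>R\<^esub> else \<zero>\<^bsub>R\<^esub>)" if "g \<in> carrier G" for g
    using that by (simp add: group_ring_def)
  have add_val: "(f \<oplus>\<^bsub>?S\<^esub> h) g = f g \<oplus>\<^bsub>R\<^esub> h g" if "g \<in> carrier G" for f h g
    using that by (simp add: group_ring_def)
  have mult_val0: "(f \<otimes>\<^bsub>?S\<^esub> h) g = (\<Oplus>\<^bsub>R\<^esub>x\<in>supp f. f x \<otimes>\<^bsub>R\<^esub> h (inv\<^bsub>G\<^esub> x \<otimes>\<^bsub>G\<^esub> g))"
    if "g \<in> carrier G" for f h g
    using that by (simp add: group_ring_def supp_def)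
  have mult_val: "(f \<otimes>\<^bsub>?S\<^esub> h) g = (\<Oplus>\<^bsub>R\<^esub>x\<in>B. f x \<otimes>\<^bsub>R\<^esub> h (inv\<^bsub>G\<^esub> x \<otimes>\<^bsub>G\<^esub> g))"
    if "f \<in> carrier ?S" "h \<in> carrier ?S" "g \<in> carrier G" "finite B" "supp f \<subseteq> B" "B \<subseteq> carrier G"
    for f h g B
  proof -
    have z: "f x = \<zero>\<^bsub>R\<^esub>" if "x \<in> B" "x \<notin> supp f" for x
      using that \<open>B \<subseteq> carrier G\<close> by (auto simp: supp_def)
    have c: "f x \<in> carrier R" "h (inv\<^bsub>G\<^esub> x \<otimes>\<^bsub>G\<^esub> g) \<in> carrier R" if "x \<in> B" for x
      using that \<open>B \<subseteq> carrier G\<close> \<open>f \<in> _\<close> \<open>h \<in> _\<close> \<open>g \<in> _\<close> by (auto intro!: cl)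
    show ?thesis
      unfolding mult_val0[OF that(3)]
      using that(4,5) by (intro R.finsum_superset) (auto simp: c z)
  qed
  have zero_in: "\<zero>\<^bsub>?S\<^esub> \<in> carrier ?S"
    by (auto simp: group_ring_def)
  have one_in: "\<one>\<^bsub>?S\<^esub> \<in> carrier ?S"
  proof -
    have "supp (\<one>\<^bsub>?S\<^esub>) \<subseteq> {\<one>\<^bsub>G\<^esub>}"
      by (auto simp: supp_def one_val split: if_splits)
    hence "finite (supp (\<one>\<^bsub>?S\<^esub>))"
      using finite_subset by blast
    thus ?thesis
      unfolding car by (auto simp: group_ring_def)
  qed
  have add_in: "f \<oplus>\<^bsub>?S\<^esub> h \<in> carrier ?S" if "f \<in> carrier ?S" "h \<in> carrier ?S" for f h
  proof -
    have "supp (f \<oplus>\<^bsub>?S\<^esub> h) \<subseteq> supp f \<union> supp h"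
      by (auto simp: supp_def add_val)
    hence "finite (supp (f \<oplus>\<^bsub>?S\<^esub> h))"
      by (rule finite_subset) (use fin that in auto)
    moreover have "f \<oplus>\<^bsub>?S\<^esub> h \<in> carrier G \<rightarrow>\<^sub>E carrier R"
      using cl that by (auto simp: group_ring_def)
    ultimately show ?thesis by (simp add: car)
  qed
  have mult_in: "f \<otimes>\<^bsub>?S\<^esub> h \<in> carrier ?S" if fh: "f \<in> carrier ?S" "h \<in> carrier ?S" for f h
  proof -
    have sub: "supp (f \<otimes>\<^bsub>?S\<^esub> h) \<subseteq> (\<lambda>(x, y). x \<otimes>\<^bsub>G\<^esub> y) ` (supp f \<times> supp h)"
    proof
      fix g assume g: "g \<in> supp (f \<otimes>\<^bsub>?S\<^esub> h)"
      hence gG: "g \<in> carrier G" and nz: "(f \<otimes>\<^bsub>?S\<^esub> h) g \<noteq> \<zero>\<^bsub>R\<^esub>"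
        by (auto simp: supp_def)
      have "\<exists>x\<in>supp f. f x \<otimes>\<^bsub>R\<^esub> h (inv\<^bsub>G\<^esub> x \<otimes>\<^bsub>G\<^esub> g) \<noteq> \<zero>\<^bsub>R\<^esub>"
      proof (rule ccontr)
        assume "\<not> ?thesis"
        hence "(f \<otimes>\<^bsub>?S\<^esub> h) g = \<zero>\<^bsub>R\<^esub>"
          unfolding mult_val0[OF gG] by (intro R.add.finprod_one_eqI) blast
        thus False using nz by contradiction
      qed
      then obtain x where x: "x \<in> supp f" "f x \<otimes>\<^bsub>R\<^esub> h (inv\<^bsub>G\<^esub> x \<otimes>\<^bsub>G\<^esub> g) \<noteq> \<zero>\<^bsub>R\<^esub>" by blast
      have xG: "x \<in> carrier G" using x suppG by blast
      have "inv\<^bsub>G\<^esub> x \<otimes>\<^bsub>G\<^esub> g \<in> supp h"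
        using x xG gG cl[OF fh(1) xG] by (auto simp: supp_def)
      moreover have "g = x \<otimes>\<^bsub>G\<^esub> (inv\<^bsub>G\<^esub> x \<otimes>\<^bsub>G\<^esub> g)"
        using xG gG by (simp add: G.m_assoc[symmetric])
      ultimately show "g \<in> (\<lambda>(x, y). x \<otimes>\<^bsub>G\<^esub> y) ` (supp f \<times> supp h)"
        using x by force
    qed
    have "finite (supp (f \<otimes>\<^bsub>?S\<^esub> h))"
      by (rule finite_subset[OF sub]) (use fin fh in auto)
    moreover have "f \<otimes>\<^bsub>?S\<^esub> h \<in> carrier G \<rightarrow>\<^sub>E carrier R"
      using cl fh by (auto simp: group_ring_def intro!: R.finsum_closed)
    ultimately show ?thesis by (simp add: car)
  qed
  show ?thesis
  proof (rule ringI)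
    show "abelian_group ?S"
    proof (rule abelian_groupI)
      fix f assume f: "f \<in> carrier ?S"
      define m where "m = (\<lambda>g\<in>carrier G. \<ominus>\<^bsub>R\<^esub> f g)"
      have "supp m \<subseteq> supp f"
        using cl[OF f] by (auto simp: supp_def m_def)
      hence m: "m \<in> carrier ?S"
        using fin[OF f] cl[OF f] by (auto simp: car m_def intro: finite_subset)
      moreover have "m \<oplus>\<^bsub>?S\<^esub> f = \<zero>\<^bsub>?S\<^esub>"
        using f m by (intro ext) (auto simp: add_in zero_in add_val zero_val m_def cl R.l_neg)
      ultimately show "\<exists>y\<in>carrier ?S. y \<oplus>\<^bsub>?S\<^esub> f = \<zero>\<^bsub>?S\<^esub>" by blast
    next
      show "f \<oplus>\<^bsub>?S\<^esub> h \<oplus>\<^bsub>?S\<^esub> k = f \<oplus>\<^bsub>?S\<^esub> (h \<oplus>\<^bsub>?S\<^esub> k)"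
        if "f \<in> carrier ?S" "h \<in> carrier ?S" "k \<in> carrier ?S" for f h k
        using that by (intro ext) (auto simp: add_in add_val cl R.a_assoc)
      show "f \<oplus>\<^bsub>?S\<^esub> h = h \<oplus>\<^bsub>?S\<^esub> f" if "f \<in> carrier ?S" "h \<in> carrier ?S" for f h
        using that by (intro ext) (auto simp: add_in add_val cl R.a_comm)
      show "\<zero>\<^bsub>?S\<^esub> \<oplus>\<^bsub>?S\<^esub> f = f" if "f \<in> carrier ?S" for f
        using that by (intro ext) (auto simp: add_in zero_in add_val zero_val cl)
    qed (auto simp: add_in zero_in)
    show "monoid ?S"
    proof (rule monoidI)
      fix f h k assume f: "f \<in> carrier ?S" and h: "h \<in> carrier ?S" and k: "k \<in> carrier ?S"
      define B where "B = (\<lambda>(x, y). x \<otimes>\<^bsub>G\<^esub> y) ` (supp f \<times> supp h) \<union> supp (f \<otimes>\<^bsub>?S\<^esub> h)"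
      have B: "finite B" "B \<subseteq> carrier G" "supp (f \<otimes>\<^bsub>?S\<^esub> h) \<subseteq> B"
        using fin[OF f] fin[OF h] fin[OF mult_in[OF f h]] suppG by (auto simp: B_def)
      show "f \<otimes>\<^bsub>?S\<^esub> h \<otimes>\<^bsub>?S\<^esub> k = f \<otimes>\<^bsub>?S\<^esub> (h \<otimes>\<^bsub>?S\<^esub> k)"
      proof (rule ext)
        fix g assume g: "g \<in> carrier G"
        have cB: "x \<in> carrier G" if "x \<in> B" for x using that B by blast
        have cf: "y \<in> carrier G" if "y \<in> supp f" for y using that suppG by blast
        have ch: "y \<in> carrier G" if "y \<in> supp h" for y using that suppG by blast
        note C = cl[OF f] cl[OF h] cl[OF k] g
        have inner: "(\<Oplus>\<^bsub>R\<^esub>x\<in>B. h (inv\<^bsub>G\<^esub> y \<otimes>\<^bsub>G\<^esub> x) \<otimes>\<^bsub>R\<^esub> k (inv\<^bsub>G\<^esub> x \<otimes>\<^bsub>G\<^esub> g))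
            = (h \<otimes>\<^bsub>?S\<^esub> k) (inv\<^bsub>G\<^esub> y \<otimes>\<^bsub>G\<^esub> g)" if y: "y \<in> supp f" for y
        proof -
          let ?F = "\<lambda>x. h (inv\<^bsub>G\<^esub> y \<otimes>\<^bsub>G\<^esub> x) \<otimes>\<^bsub>R\<^esub> k (inv\<^bsub>G\<^esub> x \<otimes>\<^bsub>G\<^esub> g)"
          have yG: "y \<in> carrier G" using y cf by blast
          have im: "(\<lambda>z. y \<otimes>\<^bsub>G\<^esub> z) ` supp h \<subseteq> B" using y by (auto simp: B_def)
          have "(\<Oplus>\<^bsub>R\<^esub>x\<in>B. ?F x) = (\<Oplus>\<^bsub>R\<^esub>x\<in>(\<lambda>z. y \<otimes>\<^bsub>G\<^esub> z) ` supp h. ?F x)"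
          proof (rule R.finsum_superset[OF B(1) im, symmetric])
            fix x assume x: "x \<in> B"
            show "?F x \<in> carrier R" using cB[OF x] yG C by simp
            assume nx: "x \<notin> (\<lambda>z. y \<otimes>\<^bsub>G\<^esub> z) ` supp h"
            have "x = y \<otimes>\<^bsub>G\<^esub> (inv\<^bsub>G\<^esub> y \<otimes>\<^bsub>G\<^esub> x)"
              using cB[OF x] yG by (simp add: G.m_assoc[symmetric])
            hence "inv\<^bsub>G\<^esub> y \<otimes>\<^bsub>G\<^esub> x \<notin> supp h" using nx by blast
            hence "h (inv\<^bsub>G\<^esub> y \<otimes>\<^bsub>G\<^esub> x) = \<zero>\<^bsub>R\<^esub>" using cB[OF x] yG by (auto simp: supp_def)
            thus "?F x = \<zero>\<^bsub>R\<^esub>" using cB[OF x] yG C by simp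
          qed
          also have "\<dots> = (\<Oplus>\<^bsub>R\<^esub>z\<in>supp h. ?F (y \<otimes>\<^bsub>G\<^esub> z))"
            by (rule R.finsum_reindex) (use yG ch C in \<open>auto simp: inj_on_def\<close>)
          also have "\<dots> = (\<Oplus>\<^bsub>R\<^esub>z\<in>supp h. h z \<otimes>\<^bsub>R\<^esub> k (inv\<^bsub>G\<^esub> z \<otimes>\<^bsub>G\<^esub> (inv\<^bsub>G\<^esub> y \<otimes>\<^bsub>G\<^esub> g)))"
          proof (rule R.finsum_cong'[OF refl])
            fix z assume z: "z \<in> supp h"
            show "?F (y \<otimes>\<^bsub>G\<^esub> z) = h z \<otimes>\<^bsub>R\<^esub> k (inv\<^bsub>G\<^esub> z \<otimes>\<^bsub>G\<^esub> (inv\<^bsub>G\<^esub> y \<otimes>\<^bsub>G\<^esub> g))"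
              using yG g ch[OF z] G.m_assoc[of "inv\<^bsub>G\<^esub> y" y z, symmetric]
              by (simp add: G.inv_mult_group G.m_assoc[of "inv\<^bsub>G\<^esub> z"])
          qed (use yG ch C in auto)
          also have "\<dots> = (h \<otimes>\<^bsub>?S\<^esub> k) (inv\<^bsub>G\<^esub> y \<otimes>\<^bsub>G\<^esub> g)"
            using yG g by (simp add: mult_val0)
          finally show ?thesis .
        qed
        have "(f \<otimes>\<^bsub>?S\<^esub> h \<otimes>\<^bsub>?S\<^esub> k) g
            = (\<Oplus>\<^bsub>R\<^esub>x\<in>B. (f \<otimes>\<^bsub>?S\<^esub> h) x \<otimes>\<^bsub>R\<^esub> k (inv\<^bsub>G\<^esub> x \<otimes>\<^bsub>G\<^esub> g))"
          by (rule mult_val[OF mult_in[OF f h] k g B(1) B(3) B(2)])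
        also have "\<dots> = (\<Oplus>\<^bsub>R\<^esub>x\<in>B. \<Oplus>\<^bsub>R\<^esub>y\<in>supp f.
            f y \<otimes>\<^bsub>R\<^esub> (h (inv\<^bsub>G\<^esub> y \<otimes>\<^bsub>G\<^esub> x) \<otimes>\<^bsub>R\<^esub> k (inv\<^bsub>G\<^esub> x \<otimes>\<^bsub>G\<^esub> g)))"
        proof (rule R.finsum_cong'[OF refl])
          fix x assume x: "x \<in> B"
          have "(f \<otimes>\<^bsub>?S\<^esub> h) x \<otimes>\<^bsub>R\<^esub> k (inv\<^bsub>G\<^esub> x \<otimes>\<^bsub>G\<^esub> g)
             = (\<Oplus>\<^bsub>R\<^esub>y\<in>supp f. f y \<otimes>\<^bsub>R\<^esub> h (inv\<^bsub>G\<^esub> y \<otimes>\<^bsub>G\<^esub> x) \<otimes>\<^bsub>R\<^esub> k (inv\<^bsub>G\<^esub> x \<otimes>\<^bsub>G\<^esub> g))"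
            unfolding mult_val0[OF cB[OF x]]
            by (rule R.finsum_ldistr) (use fin[OF f] cB[OF x] cf C in auto)
          also have "\<dots> = (\<Oplus>\<^bsub>R\<^esub>y\<in>supp f.
              f y \<otimes>\<^bsub>R\<^esub> (h (inv\<^bsub>G\<^esub> y \<otimes>\<^bsub>G\<^esub> x) \<otimes>\<^bsub>R\<^esub> k (inv\<^bsub>G\<^esub> x \<otimes>\<^bsub>G\<^esub> g)))"
            by (rule R.finsum_cong'[OF refl]) (use cB[OF x] cf C in \<open>auto simp: R.m_assoc\<close>)
          finally show "(f \<otimes>\<^bsub>?S\<^esub> h) x \<otimes>\<^bsub>R\<^esub> k (inv\<^bsub>G\<^esub> x \<otimes>\<^bsub>G\<^esub> g) = \<dots>" .
        qed (use cB cf C in \<open>auto intro!: R.finsum_closed\<close>)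
        also have "\<dots> = (\<Oplus>\<^bsub>R\<^esub>y\<in>supp f. \<Oplus>\<^bsub>R\<^esub>x\<in>B.
            f y \<otimes>\<^bsub>R\<^esub> (h (inv\<^bsub>G\<^esub> y \<otimes>\<^bsub>G\<^esub> x) \<otimes>\<^bsub>R\<^esub> k (inv\<^bsub>G\<^esub> x \<otimes>\<^bsub>G\<^esub> g)))"
          by (rule R.finsum_exchange) (use B(1) fin[OF f] cB cf C in auto)
        also have "\<dots> = (\<Oplus>\<^bsub>R\<^esub>y\<in>supp f. f y \<otimes>\<^bsub>R\<^esub> (h \<otimes>\<^bsub>?S\<^esub> k) (inv\<^bsub>G\<^esub> y \<otimes>\<^bsub>G\<^esub> g))"
        proof (rule R.finsum_cong'[OF refl])
          fix y assume y: "y \<in> supp f"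
          show "(\<Oplus>\<^bsub>R\<^esub>x\<in>B. f y \<otimes>\<^bsub>R\<^esub> (h (inv\<^bsub>G\<^esub> y \<otimes>\<^bsub>G\<^esub> x) \<otimes>\<^bsub>R\<^esub> k (inv\<^bsub>G\<^esub> x \<otimes>\<^bsub>G\<^esub> g)))
              = f y \<otimes>\<^bsub>R\<^esub> (h \<otimes>\<^bsub>?S\<^esub> k) (inv\<^bsub>G\<^esub> y \<otimes>\<^bsub>G\<^esub> g)"
            unfolding inner[OF y, symmetric]
            by (rule R.finsum_rdistr[symmetric]) (use B(1) cB cf[OF y] C in auto)
        qed (use cl[OF mult_in[OF h k]] cf C in auto)
        also have "\<dots> = (f \<otimes>\<^bsub>?S\<^esub> (h \<otimes>\<^bsub>?S\<^esub> k)) g"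
          using g by (simp add: mult_val0)
        finally show "(f \<otimes>\<^bsub>?S\<^esub> h \<otimes>\<^bsub>?S\<^esub> k) g = (f \<otimes>\<^bsub>?S\<^esub> (h \<otimes>\<^bsub>?S\<^esub> k)) g" .
      qed (auto simp: mult_in f h k)
    next
      fix f assume f: "f \<in> carrier ?S"
      show "\<one>\<^bsub>?S\<^esub> \<otimes>\<^bsub>?S\<^esub> f = f"
      proof (rule ext)
        fix g assume g: "g \<in> carrier G"
        have "supp (\<one>\<^bsub>?S\<^esub>) \<subseteq> {\<one>\<^bsub>G\<^esub>}"
          by (auto simp: supp_def one_val split: if_splits)
        hence "(\<one>\<^bsub>?S\<^esub> \<otimes>\<^bsub>?S\<^esub> f) g
            = (\<Oplus>\<^bsub>R\<^esub>x\<in>{\<one>\<^bsub>G\<^esub>}. \<one>\<^bsub>?S\<^esub> x \<otimes>\<^bsub>R\<^esub> f (inv\<^bsub>G\<^esub> x \<otimes>\<^bsub>G\<^esub> g))"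
          using one_in f g by (intro mult_val) auto
        thus "(\<one>\<^bsub>?S\<^esub> \<otimes>\<^bsub>?S\<^esub> f) g = f g"
          using cl[OF f g] g by (simp add: one_val)
      qed (auto simp: mult_in one_in f)
      show "f \<otimes>\<^bsub>?S\<^esub> \<one>\<^bsub>?S\<^esub> = f"
      proof (rule ext)
        fix g assume g: "g \<in> carrier G"
        have "(f \<otimes>\<^bsub>?S\<^esub> \<one>\<^bsub>?S\<^esub>) g
            = (\<Oplus>\<^bsub>R\<^esub>x\<in>insert g (supp f). f x \<otimes>\<^bsub>R\<^esub> \<one>\<^bsub>?S\<^esub> (inv\<^bsub>G\<^esub> x \<otimes>\<^bsub>G\<^esub> g))"
          using one_in f g suppG fin[OF f] by (intro mult_val) auto
        also have "\<dots> = (\<Oplus>\<^bsub>R\<^esub>x\<in>insert g (supp f). if g = x then f x else \<zero>\<^bsub>R\<^esub>)"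
        proof (rule R.finsum_cong'[OF refl])
          fix x assume "x \<in> insert g (supp f)"
          hence x: "x \<in> carrier G" using g suppG by auto
          have "inv\<^bsub>G\<^esub> x \<otimes>\<^bsub>G\<^esub> g = \<one>\<^bsub>G\<^esub> \<longleftrightarrow> g = x"
            using G.inv_solve_left'[of "\<one>\<^bsub>G\<^esub>" x g] x g by auto
          thus "f x \<otimes>\<^bsub>R\<^esub> \<one>\<^bsub>?S\<^esub> (inv\<^bsub>G\<^esub> x \<otimes>\<^bsub>G\<^esub> g) = (if g = x then f x else \<zero>\<^bsub>R\<^esub>)"
            using x g cl[OF f x] by (simp add: one_val)
        qed (use cl[OF f] g suppG in auto)
        also have "\<dots> = f g"
          by (rule R.finsum_singleton) (use cl[OF f] g suppG fin[OF f] in auto)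
        finally show "(f \<otimes>\<^bsub>?S\<^esub> \<one>\<^bsub>?S\<^esub>) g = f g" .
      qed (auto simp: mult_in one_in f)
    qed (auto simp: mult_in one_in)
  next
    fix f h k assume f: "f \<in> carrier ?S" and h: "h \<in> carrier ?S" and k: "k \<in> carrier ?S"
    show "(f \<oplus>\<^bsub>?S\<^esub> h) \<otimes>\<^bsub>?S\<^esub> k = f \<otimes>\<^bsub>?S\<^esub> k \<oplus>\<^bsub>?S\<^esub> h \<otimes>\<^bsub>?S\<^esub> k"
    proof (rule ext)
      fix g assume g: "g \<in> carrier G"
      define B where "B = supp f \<union> supp h"
      have B: "finite B" "B \<subseteq> carrier G" "supp f \<subseteq> B" "supp h \<subseteq> B" "supp (f \<oplus>\<^bsub>?S\<^esub> h) \<subseteq> B"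
        using fin[OF f] fin[OF h] by (auto simp: B_def supp_def add_val)
      have cB: "x \<in> carrier G" if "x \<in> B" for x using that B by blast
      note C = cl[OF f] cl[OF h] cl[OF k] g cB
      have "((f \<oplus>\<^bsub>?S\<^esub> h) \<otimes>\<^bsub>?S\<^esub> k) g
          = (\<Oplus>\<^bsub>R\<^esub>x\<in>B. (f \<oplus>\<^bsub>?S\<^esub> h) x \<otimes>\<^bsub>R\<^esub> k (inv\<^bsub>G\<^esub> x \<otimes>\<^bsub>G\<^esub> g))"
        by (rule mult_val[OF add_in[OF f h] k g B(1) B(5) B(2)])
      also have "\<dots> = (\<Oplus>\<^bsub>R\<^esub>x\<in>B. f x \<otimes>\<^bsub>R\<^esub> k (inv\<^bsub>G\<^esub> x \<otimes>\<^bsub>G\<^esub> g)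
          \<oplus>\<^bsub>R\<^esub> h x \<otimes>\<^bsub>R\<^esub> k (inv\<^bsub>G\<^esub> x \<otimes>\<^bsub>G\<^esub> g))"
        by (rule R.finsum_cong'[OF refl]) (use C in \<open>auto simp: add_val R.l_distr\<close>)
      also have "\<dots> = (\<Oplus>\<^bsub>R\<^esub>x\<in>B. f x \<otimes>\<^bsub>R\<^esub> k (inv\<^bsub>G\<^esub> x \<otimes>\<^bsub>G\<^esub> g))
          \<oplus>\<^bsub>R\<^esub> (\<Oplus>\<^bsub>R\<^esub>x\<in>B. h x \<otimes>\<^bsub>R\<^esub> k (inv\<^bsub>G\<^esub> x \<otimes>\<^bsub>G\<^esub> g))"
        by (rule R.finsum_addf) (use C in auto)
      also have "\<dots> = (f \<otimes>\<^bsub>?S\<^esub> k \<oplus>\<^bsub>?S\<^esub> h \<otimes>\<^bsub>?S\<^esub> k) g"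
        using mult_val[OF f k g B(1,3,2)] mult_val[OF h k g B(1,4,2)] g by (simp add: add_val)
      finally show "((f \<oplus>\<^bsub>?S\<^esub> h) \<otimes>\<^bsub>?S\<^esub> k) g = (f \<otimes>\<^bsub>?S\<^esub> k \<oplus>\<^bsub>?S\<^esub> h \<otimes>\<^bsub>?S\<^esub> k) g" .
    qed (auto simp: add_in mult_in f h k)
    show "k \<otimes>\<^bsub>?S\<^esub> (f \<oplus>\<^bsub>?S\<^esub> h) = k \<otimes>\<^bsub>?S\<^esub> f \<oplus>\<^bsub>?S\<^esub> k \<otimes>\<^bsub>?S\<^esub> h"
    proof (rule ext)
      fix g assume g: "g \<in> carrier G"
      have cB: "x \<in> carrier G" if "x \<in> supp k" for x using that suppG by blast
      note C = cl[OF f] cl[OF h] cl[OF k] g cB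
      have "(k \<otimes>\<^bsub>?S\<^esub> (f \<oplus>\<^bsub>?S\<^esub> h)) g
          = (\<Oplus>\<^bsub>R\<^esub>x\<in>supp k. k x \<otimes>\<^bsub>R\<^esub> f (inv\<^bsub>G\<^esub> x \<otimes>\<^bsub>G\<^esub> g)
            \<oplus>\<^bsub>R\<^esub> k x \<otimes>\<^bsub>R\<^esub> h (inv\<^bsub>G\<^esub> x \<otimes>\<^bsub>G\<^esub> g))"
        unfolding mult_val0[OF g]
        by (rule R.finsum_cong'[OF refl]) (use C in \<open>auto simp: add_val R.r_distr\<close>)
      also have "\<dots> = (\<Oplus>\<^bsub>R\<^esub>x\<in>supp k. k x \<otimes>\<^bsub>R\<^esub> f (inv\<^bsub>G\<^esub> x \<otimes>\<^bsub>G\<^esub> g))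
          \<oplus>\<^bsub>R\<^esub> (\<Oplus>\<^bsub>R\<^esub>x\<in>supp k. k x \<otimes>\<^bsub>R\<^esub> h (inv\<^bsub>G\<^esub> x \<otimes>\<^bsub>G\<^esub> g))"
        by (rule R.finsum_addf) (use C in auto)
      also have "\<dots> = (k \<otimes>\<^bsub>?S\<^esub> f \<oplus>\<^bsub>?S\<^esub> k \<otimes>\<^bsub>?S\<^esub> h) g"
        using g by (simp add: add_val mult_val0)
      finally show "(k \<otimes>\<^bsub>?S\<^esub> (f \<oplus>\<^bsub>?S\<^esub> h)) g = (k \<otimes>\<^bsub>?S\<^esub> f \<oplus>\<^bsub>?S\<^esub> k \<otimes>\<^bsub>?S\<^esub> h) g" .
    qed (auto simp: add_in mult_in f h k)
  qed
qed

end

theory Submission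
  imports Defs
begin

text \<open>
  A unit-regular NI-ring is reduced, so each of its elements generates an ideal spanned by a central
  idempotent.  Let \<open>a\<close> be an element of \<open>S = RG\<close>, let \<open>H\<close> be the finite subgroup generated by its
  support, and \<open>n = |H|\<close>.  The \<open>n + 1\<close> vectors \<open>1, a, \<dots>, a ^ n\<close> lie in the free module on \<open>H\<close>, so
  over a division ring they would be linearly dependent, and the lowest nonzero coefficient of a
  relation would give \<open>a ^ k \<in> S a ^ (k + 1)\<close> for some \<open>k \<le> n\<close>.  Gaussian elimination in which the
  case distinction on a pivot is replaced by a splitting of \<open>1\<close> into central idempotents gives
  \<open>a ^ n \<in> S a ^ (n + 1)\<close> over \<open>R\<close>, and the opposite rings give \<open>a ^ n \<in> a ^ (n + 1) S\<close>.  Hence \<open>a\<close>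
  is strongly pi-regular: for some idempotent \<open>e\<close> that commutes with \<open>a\<close>, it is invertible on the
  corner of \<open>e\<close> and nilpotent on that of \<open>1 - e\<close>.  The inverse on the first corner plus \<open>1 - e\<close> is the
  required unit.
\<close>

section \<open>Reduced regular rings\<close>

lemma (in ring) pow_idem:
  "e \<in> carrier R \<Longrightarrow> e \<otimes> e = e \<Longrightarrow> e [^] Suc n = e"
  by (induction n) auto

text \<open>With \<open>a = a u a\<close>, the product \<open>u a\<close> is idempotent, and it is
  nilpotent because the nilpotents form an ideal. A nilpotent idempotent is zero, hence
  \<open>a = a (u a) = 0\<close>.\<close>

lemma (in ring) regular_NI_imp_reduced:
  assumes "NI_ring R" "unit_regular R" "a \<in> nilpotents R"
  shows "a = \<zero>"
proof -
  interpret N: ideal "nilpotents R" R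
    using assms(1) by (simp add: NI_ring_def)
  have a: "a \<in> carrier R" using N.a_subset assms(3) by blast
  then obtain u where u: "u \<in> carrier R" "a = a \<otimes> u \<otimes> a"
    using assms(2) unfolding unit_regular_def Units_def by blast
  have e: "u \<otimes> a \<in> nilpotents R" using N.I_l_closed assms(3) u by blast
  have "u \<otimes> a \<otimes> (u \<otimes> a) = u \<otimes> (a \<otimes> u \<otimes> a)"
    using a u(1) by (simp add: m_assoc)
  hence idem: "u \<otimes> a \<otimes> (u \<otimes> a) = u \<otimes> a" using u(2) by simp
  obtain n :: nat where n: "(u \<otimes> a) [^] n = \<zero>"
    using e unfolding nilpotents_def by blast
  \<comment> \<open>A positive exponent is needed, since the power of an idempotent with exponent 0
    is 1.\<close>
  have "(u \<otimes> a) [^] Suc n = \<zero>" using a u(1) n by simp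
  hence "u \<otimes> a = \<zero>" using pow_idem[OF _ idem] a u(1) by simp
  moreover have "a = a \<otimes> (u \<otimes> a)"
    using m_assoc[OF a u(1) a] u(2) by (rule trans[rotated])
  ultimately show ?thesis using a by (metis r_null)
qed

lemma (in ring) reduced_square:
  assumes "\<And>a. a \<in> nilpotents R \<Longrightarrow> a = \<zero>" "x \<in> carrier R" "x \<otimes> x = \<zero>"
  shows "x = \<zero>"
proof -
  have "x [^] (2::nat) = \<zero>" using assms(2,3) by (simp add: numeral_2_eq_2)
  thus ?thesis using assms(1,2) unfolding nilpotents_def by blast
qed

text \<open>Both \<open>e r (1 - e)\<close> and \<open>(1 - e) r e\<close> square to zero, because
  \<open>e (1 - e) = (1 - e) e = 0\<close>. In a reduced ring they vanish, so
  \<open>e r = e r e = r e\<close>.\<close>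

lemma (in ring) reduced_idempotent_central:
  assumes red: "\<And>a. a \<in> nilpotents R \<Longrightarrow> a = \<zero>"
    and e: "e \<in> carrier R" "e \<otimes> e = e" and r: "r \<in> carrier R"
  shows "e \<otimes> r = r \<otimes> e"
proof -
  have ee: "e \<otimes> (e \<otimes> z) = e \<otimes> z" if "z \<in> carrier R" for z
    using that e by (simp add: m_assoc[symmetric])
  have "e \<otimes> r \<ominus> e \<otimes> r \<otimes> e = \<zero>"
    by (rule reduced_square[OF red])
      (use e r ee in \<open>simp_all add: minus_eq l_distr r_distr l_minus r_minus m_assoc r_neg\<close>)
  moreover have "r \<otimes> e \<ominus> e \<otimes> r \<otimes> e = \<zero>"
    by (rule reduced_square[OF red])
      (use e r ee in \<open>simp_all add: minus_eq l_distr r_distr l_minus r_minus m_assoc r_neg\<close>)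
  ultimately show ?thesis using e r by (metis m_closed r_right_minus_eq)
qed

section \<open>Gaussian elimination with central idempotents\<close>

text \<open>Through \<open>coord\<close>, \<open>V\<close> embeds as a submodule of the free left
  module on \<open>H\<close>. The setting is abstract so that one elimination serves both the group
  ring and its opposite.\<close>

locale regular_coordinates = R: ring R + S: ring S
  for R :: "('a, 'm) ring_scheme" and S :: "('b, 'n) ring_scheme" +
  fixes scal :: "'a \<Rightarrow> 'b" and V :: "'b set" and H :: "'h set" and coord :: "'h \<Rightarrow> 'b \<Rightarrow> 'a"
  assumes regular: "c \<in> carrier R \<Longrightarrow> \<exists>d\<in>carrier R. c = c \<otimes>\<^bsub>R\<^esub> d \<otimes>\<^bsub>R\<^esub> c"
    and central: "e \<in> carrier R \<Longrightarrow> e \<otimes>\<^bsub>R\<^esub> e = e \<Longrightarrow> r \<in> carrier R \<Longrightarrow> e \<otimes>\<^bsub>R\<^esub> r = r \<otimes>\<^bsub>R\<^esub> e"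
    and scal_closed: "r \<in> carrier R \<Longrightarrow> scal r \<in> carrier S"
    and scal_add: "r \<in> carrier R \<Longrightarrow> r' \<in> carrier R \<Longrightarrow> scal (r \<oplus>\<^bsub>R\<^esub> r') = scal r \<oplus>\<^bsub>S\<^esub> scal r'"
    and scal_one: "scal \<one>\<^bsub>R\<^esub> = \<one>\<^bsub>S\<^esub>"
    and V_add: "v \<in> V \<Longrightarrow> w \<in> V \<Longrightarrow> v \<oplus>\<^bsub>S\<^esub> w \<in> V"
    and V_scal: "r \<in> carrier R \<Longrightarrow> v \<in> V \<Longrightarrow> scal r \<otimes>\<^bsub>S\<^esub> v \<in> V"
    and finite_H: "finite H"
    and coord_closed: "h \<in> H \<Longrightarrow> v \<in> V \<Longrightarrow> coord h v \<in> carrier R"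
    and coord_add: "h \<in> H \<Longrightarrow> v \<in> V \<Longrightarrow> w \<in> V \<Longrightarrow>
      coord h (v \<oplus>\<^bsub>S\<^esub> w) = coord h v \<oplus>\<^bsub>R\<^esub> coord h w"
    and coord_scal: "h \<in> H \<Longrightarrow> r \<in> carrier R \<Longrightarrow> v \<in> V \<Longrightarrow>
      coord h (scal r \<otimes>\<^bsub>S\<^esub> v) = r \<otimes>\<^bsub>R\<^esub> coord h v"
    and coord_separate: "v \<in> V \<Longrightarrow> (\<And>h. h \<in> H \<Longrightarrow> coord h v = \<zero>\<^bsub>R\<^esub>) \<Longrightarrow> v = \<zero>\<^bsub>S\<^esub>"
begin

text \<open>The left ideal generated by \<open>a ^ m\<close>, which collects the higher-order terms
  of a row.\<close>

abbreviation L :: "'b \<Rightarrow> nat \<Rightarrow> 'b set"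
  where "L a m \<equiv> {s \<otimes>\<^bsub>S\<^esub> a [^]\<^bsub>S\<^esub> m | s. s \<in> carrier S}"

lemma L_closed: "a \<in> carrier S \<Longrightarrow> x \<in> L a m \<Longrightarrow> x \<in> carrier S"
  by auto

lemma L_add:
  assumes "a \<in> carrier S" "x \<in> L a m" "y \<in> L a m"
  shows "x \<oplus>\<^bsub>S\<^esub> y \<in> L a m"
proof -
  obtain s t where "s \<in> carrier S" "t \<in> carrier S" "x = s \<otimes>\<^bsub>S\<^esub> a [^]\<^bsub>S\<^esub> m" "y = t \<otimes>\<^bsub>S\<^esub> a [^]\<^bsub>S\<^esub> m"
    using assms by blast
  hence "s \<oplus>\<^bsub>S\<^esub> t \<in> carrier S" "x \<oplus>\<^bsub>S\<^esub> y = (s \<oplus>\<^bsub>S\<^esub> t) \<otimes>\<^bsub>S\<^esub> a [^]\<^bsub>S\<^esub> m"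
    using assms(1) by (simp_all add: S.l_distr)
  thus ?thesis by blast
qed

lemma L_mult:
  assumes "a \<in> carrier S" "x \<in> L a m" "t \<in> carrier S"
  shows "t \<otimes>\<^bsub>S\<^esub> x \<in> L a m"
proof -
  obtain s where "s \<in> carrier S" "x = s \<otimes>\<^bsub>S\<^esub> a [^]\<^bsub>S\<^esub> m"
    using assms by blast
  hence "t \<otimes>\<^bsub>S\<^esub> s \<in> carrier S" "t \<otimes>\<^bsub>S\<^esub> x = (t \<otimes>\<^bsub>S\<^esub> s) \<otimes>\<^bsub>S\<^esub> a [^]\<^bsub>S\<^esub> m"
    using assms by (simp_all add: S.m_assoc)
  thus ?thesis by blast
qed

lemma L_shift:
  assumes "a \<in> carrier S" "x \<in> L a m"
  shows "x \<otimes>\<^bsub>S\<^esub> a [^]\<^bsub>S\<^esub> k \<in> L a (m + k)"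
proof -
  obtain s where "s \<in> carrier S" "x = s \<otimes>\<^bsub>S\<^esub> a [^]\<^bsub>S\<^esub> m"
    using assms by blast
  hence "s \<in> carrier S" "x \<otimes>\<^bsub>S\<^esub> a [^]\<^bsub>S\<^esub> k = s \<otimes>\<^bsub>S\<^esub> a [^]\<^bsub>S\<^esub> (m + k)"
    using assms by (simp_all add: S.m_assoc S.nat_pow_mult)
  thus ?thesis by blast
qed

lemma L_antimono:
  assumes "a \<in> carrier S" "m \<le> k" "x \<in> L a k"
  shows "x \<in> L a m"
proof -
  obtain s where s: "s \<in> carrier S" "x = s \<otimes>\<^bsub>S\<^esub> a [^]\<^bsub>S\<^esub> k"
    using assms by blast
  have "a [^]\<^bsub>S\<^esub> k = a [^]\<^bsub>S\<^esub> (k - m) \<otimes>\<^bsub>S\<^esub> a [^]\<^bsub>S\<^esub> m"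
    using assms by (simp add: S.nat_pow_mult)
  hence "x = (s \<otimes>\<^bsub>S\<^esub> a [^]\<^bsub>S\<^esub> (k - m)) \<otimes>\<^bsub>S\<^esub> a [^]\<^bsub>S\<^esub> m"
    using s assms(1) by (simp add: S.m_assoc)
  thus ?thesis using s assms(1) by blast
qed

text \<open>In the induction \<open>w i\<close> is the current value of the row that starts as \<open>a ^ i\<close>, \<open>e\<close> is the
  idempotent piece being worked on, and \<open>D\<close> contains the columns in which a row can be nonzero on
  that piece.  The pivot is always the row of highest index, so that elimination changes \<open>w i\<close> only
  by elements of \<open>S a ^ (i + 1)\<close>.\<close>

lemma elimination:
  assumes a: "a \<in> carrier S"
    and "finite D" "D \<subseteq> H" "K \<subseteq> {..N}" "card D < card K"
    and "e \<in> carrier R" "e \<otimes>\<^bsub>R\<^esub> e = e"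
    and "\<And>i. i \<in> K \<Longrightarrow> w i \<in> V"
    and "\<And>i. i \<in> K \<Longrightarrow> \<exists>y\<in>L a (Suc i). w i = a [^]\<^bsub>S\<^esub> i \<oplus>\<^bsub>S\<^esub> y"
    and "\<And>i h. i \<in> K \<Longrightarrow> h \<in> H - D \<Longrightarrow> e \<otimes>\<^bsub>R\<^esub> coord h (w i) = \<zero>\<^bsub>R\<^esub>"
  shows "scal e \<otimes>\<^bsub>S\<^esub> a [^]\<^bsub>S\<^esub> N \<in> L a (Suc N)"
  using assms(2-)
proof (induction D arbitrary: K e w rule: finite_induct)
  case empty
  then obtain k where k: "k \<in> K" by fastforce
  have kN: "k \<le> N" using k empty.prems(2) by auto
  have se: "scal e \<in> carrier S" using empty.prems by (simp add: scal_closed)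
  have wk: "w k \<in> V" using empty.prems k by blast
  \<comment> \<open>No column is left, so a surviving row vanishes on the piece \<open>e\<close>.
    This is a relation with lowest term \<open>e a ^ k\<close>.\<close>
  have "scal e \<otimes>\<^bsub>S\<^esub> w k = \<zero>\<^bsub>S\<^esub>"
    using empty.prems k wk by (intro coord_separate V_scal) (auto simp: coord_scal)
  moreover obtain y where y: "y \<in> L a (Suc k)" "w k = a [^]\<^bsub>S\<^esub> k \<oplus>\<^bsub>S\<^esub> y"
    using empty.prems k by blast
  ultimately have 0: "scal e \<otimes>\<^bsub>S\<^esub> a [^]\<^bsub>S\<^esub> k \<oplus>\<^bsub>S\<^esub> scal e \<otimes>\<^bsub>S\<^esub> y = \<zero>\<^bsub>S\<^esub>"
    using se a L_closed[OF a y(1)] by (simp add: S.r_distr)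
  have "\<ominus>\<^bsub>S\<^esub> scal e \<otimes>\<^bsub>S\<^esub> y \<in> L a (Suc k)"
    using L_mult[OF a y(1)] se by blast
  moreover have "scal e \<otimes>\<^bsub>S\<^esub> a [^]\<^bsub>S\<^esub> k = \<ominus>\<^bsub>S\<^esub> scal e \<otimes>\<^bsub>S\<^esub> y"
    using S.minus_equality[OF 0] S.l_minus se a L_closed[OF a y(1)]
    by (metis S.m_closed S.nat_pow_closed)
  ultimately have "scal e \<otimes>\<^bsub>S\<^esub> a [^]\<^bsub>S\<^esub> k \<in> L a (Suc k)" by simp
  \<comment> \<open>Multiplying by \<open>a ^ (N - k)\<close> on the right gives all pieces the same
    exponent \<open>N\<close>, so that they can be added later.\<close>
  from L_shift[OF a this, of "N - k"] show ?case
    using kN se a by (simp add: S.m_assoc S.nat_pow_mult)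
next
  case (insert h D)
  have hH: "h \<in> H" and DH: "D \<subseteq> H" using insert.prems by auto
  have cardD: "card D < card K" "card D + 1 < card K" using insert by auto
  \<comment> \<open>Inner induction on the number of rows whose entry in column \<open>h\<close> is
    nonzero on the piece \<open>e\<close>. Each round splits \<open>e\<close> into \<open>f\<close>,
    where the pivot is invertible, and \<open>e'\<close>, where it vanishes.\<close>
  show ?case
    using insert.prems(4-)
  proof (induction "card {i \<in> K. e \<otimes>\<^bsub>R\<^esub> coord h (w i) \<noteq> \<zero>\<^bsub>R\<^esub>}" arbitrary: e rule: less_induct)
    case less
    let ?P = "\<lambda>e. {i \<in> K. e \<otimes>\<^bsub>R\<^esub> coord h (w i) \<noteq> \<zero>\<^bsub>R\<^esub>}"
    note e = less.prems(1,2)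
    note wV = less.prems(3) and wL = less.prems(4) and w0 = less.prems(5)
    have finK: "finite K" using insert.prems(2) finite_subset by blast
    have wR: "coord g (w i) \<in> carrier R" if "g \<in> H" "i \<in> K" for g i
      using that wV coord_closed by blast
    show ?case
    proof (cases "?P e = {}")
      \<comment> \<open>Column \<open>h\<close> is zero on this piece already, so it is dropped
        without using up a row.\<close>
      case True
      show ?thesis
        using insert.prems(2) DH cardD e wV wL
      proof (intro insert.IH[of K e w])
        fix i g assume "i \<in> K" "g \<in> H - D"
        thus "e \<otimes>\<^bsub>R\<^esub> coord g (w i) = \<zero>\<^bsub>R\<^esub>"
          using True w0 by (cases "g = h") auto
      qed auto
    next
      case False
      define j where "j = Max (?P e)"
      have finP: "finite (?P e)" using finK by simp
      have j: "j \<in> K" "e \<otimes>\<^bsub>R\<^esub> coord h (w j) \<noteq> \<zero>\<^bsub>R\<^esub>"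
        using Max_in[OF finP False] by (auto simp: j_def)
      have above: "e \<otimes>\<^bsub>R\<^esub> coord h (w i) = \<zero>\<^bsub>R\<^esub>" if "i \<in> K" "j < i" for i
        using Max_ge[OF finP, of i] that by (auto simp: j_def)
      define c where "c = e \<otimes>\<^bsub>R\<^esub> coord h (w j)"
      have c: "c \<in> carrier R" using e wR[OF hH j(1)] by (simp add: c_def)
      obtain d where d: "d \<in> carrier R" "c = c \<otimes>\<^bsub>R\<^esub> d \<otimes>\<^bsub>R\<^esub> c"
        using regular[OF c] by blast
      \<comment> \<open>This central idempotent below \<open>e\<close> acts as identity on
        \<open>c\<close>; on its piece \<open>d\<close> is a left inverse of the pivot
        entry.\<close>
      define f where "f = d \<otimes>\<^bsub>R\<^esub> c"
      have f: "f \<in> carrier R" using c d by (simp add: f_def)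
      have cf: "c \<otimes>\<^bsub>R\<^esub> f = c" using c d by (simp add: f_def R.m_assoc)
      have ff: "f \<otimes>\<^bsub>R\<^esub> f = f"
        using R.m_assoc[of d c f] c d f cf by (simp add: f_def)
      have fcen: "f \<otimes>\<^bsub>R\<^esub> r = r \<otimes>\<^bsub>R\<^esub> f" if "r \<in> carrier R" for r
        using central f ff that by blast
      have ecen: "e \<otimes>\<^bsub>R\<^esub> r = r \<otimes>\<^bsub>R\<^esub> e" if "r \<in> carrier R" for r
        using central e that by blast
      have ec: "e \<otimes>\<^bsub>R\<^esub> c = c"
        using e wR[OF hH j(1)] by (simp add: c_def R.m_assoc[symmetric])
      have fc: "f \<otimes>\<^bsub>R\<^esub> c = c" using cf fcen c by simp
      have fe: "f \<otimes>\<^bsub>R\<^esub> e = f"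
      proof -
        have "f \<otimes>\<^bsub>R\<^esub> e = d \<otimes>\<^bsub>R\<^esub> (e \<otimes>\<^bsub>R\<^esub> c)"
          using c d e ecen[OF c] by (simp add: f_def R.m_assoc)
        thus ?thesis by (simp add: ec f_def)
      qed
      have ef: "e \<otimes>\<^bsub>R\<^esub> f = f" using ecen[OF f] fe by simp
      have f_zero: "f \<otimes>\<^bsub>R\<^esub> x = \<zero>\<^bsub>R\<^esub>" if "x \<in> carrier R" "e \<otimes>\<^bsub>R\<^esub> x = \<zero>\<^bsub>R\<^esub>" for x
      proof -
        have "f \<otimes>\<^bsub>R\<^esub> x = f \<otimes>\<^bsub>R\<^esub> (e \<otimes>\<^bsub>R\<^esub> x)"
          using that(1) e f fe by (simp add: R.m_assoc[symmetric])
        thus ?thesis using that f by simp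
      qed

      \<comment> \<open>On the complementary piece the entry of row \<open>j\<close> vanishes
        because \<open>f c = c\<close>, and entries that vanish on \<open>e\<close> still vanish. So
        the count drops and the inner hypothesis applies to the same rows.\<close>
      define e' where "e' = e \<ominus>\<^bsub>R\<^esub> f"
      have e': "e' \<in> carrier R" using e f by (simp add: e'_def)
      have e'e': "e' \<otimes>\<^bsub>R\<^esub> e' = e'"
        using e f ef fe ff
        by (simp add: e'_def R.minus_eq R.l_distr R.r_distr R.l_minus R.r_minus R.r_neg R.l_neg R.a_assoc)
      have e'_zero: "e' \<otimes>\<^bsub>R\<^esub> x = \<zero>\<^bsub>R\<^esub>" if "x \<in> carrier R" "e \<otimes>\<^bsub>R\<^esub> x = \<zero>\<^bsub>R\<^esub>" for x
        using that f_zero[OF that] e f by (simp add: e'_def R.minus_eq R.l_distr R.l_minus)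
      have "f \<otimes>\<^bsub>R\<^esub> coord h (w j) = f \<otimes>\<^bsub>R\<^esub> c"
        using f e fe wR[OF hH j(1)] by (simp add: c_def R.m_assoc[symmetric])
      hence e'j: "e' \<otimes>\<^bsub>R\<^esub> coord h (w j) = \<zero>\<^bsub>R\<^esub>"
        using f e wR[OF hH j(1)] c
        by (simp add: e'_def R.minus_eq R.l_distr R.l_minus fc R.r_neg flip: c_def)
      have "?P e' \<subset> ?P e"
      proof
        show "?P e' \<subseteq> ?P e" using e'_zero wR[OF hH] by blast
        show "?P e' \<noteq> ?P e" using e'j j by blast
      qed
      hence "card (?P e') < card (?P e)" using finP by (simp add: psubset_card_mono)
      hence on_e': "scal e' \<otimes>\<^bsub>S\<^esub> a [^]\<^bsub>S\<^esub> N \<in> L a (Suc N)"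
      proof (rule less.hyps[OF _ e' e'e' wV wL])
        fix i g assume ig: "i \<in> K" "g \<in> H - insert h D"
        show "e' \<otimes>\<^bsub>R\<^esub> coord g (w i) = \<zero>\<^bsub>R\<^esub>"
          using ig w0[OF ig] by (intro e'_zero wR) auto
      qed

      \<comment> \<open>Adding \<open>r i\<close> times row \<open>j\<close> turns the entry
        \<open>t\<close> of row \<open>i\<close> in column \<open>h\<close> into
        \<open>t - t f\<close>, which \<open>f\<close> kills. The factor \<open>e\<close> makes the
        added multiple vanish in the columns outside \<open>insert h D\<close>.\<close>
      define r where "r i = \<ominus>\<^bsub>R\<^esub> (coord h (w i) \<otimes>\<^bsub>R\<^esub> d \<otimes>\<^bsub>R\<^esub> e)" for i
      have r: "r i \<in> carrier R" if "i \<in> K" for i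
        using wR[OF hH that] d e by (simp add: r_def)
      \<comment> \<open>Rows of index above \<open>j\<close> stay as they are: by maximality of
        \<open>j\<close> their entry in column \<open>h\<close> is zero on \<open>e\<close>.\<close>
      define w' where "w' i = (if i < j then w i \<oplus>\<^bsub>S\<^esub> scal (r i) \<otimes>\<^bsub>S\<^esub> w j else w i)" for i
      have w'V: "w' i \<in> V" if "i \<in> K" for i
        using that j(1) wV r by (auto simp: w'_def V_add V_scal)
      have w'L: "\<exists>y\<in>L a (Suc i). w' i = a [^]\<^bsub>S\<^esub> i \<oplus>\<^bsub>S\<^esub> y" if i: "i \<in> K" for i
      proof (cases "i < j")
        case True
        obtain y where y: "y \<in> L a (Suc i)" "w i = a [^]\<^bsub>S\<^esub> i \<oplus>\<^bsub>S\<^esub> y"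
          using wL[OF i] by (elim bexE)
        obtain z where z: "z \<in> L a (Suc j)" "w j = a [^]\<^bsub>S\<^esub> j \<oplus>\<^bsub>S\<^esub> z"
          using wL[OF j(1)] by (elim bexE)
        have "a [^]\<^bsub>S\<^esub> j = \<one>\<^bsub>S\<^esub> \<otimes>\<^bsub>S\<^esub> a [^]\<^bsub>S\<^esub> j" using a by simp
        hence "a [^]\<^bsub>S\<^esub> j \<in> L a j" by blast
        hence "w j \<in> L a j" using L_add[OF a _ L_antimono[OF a _ z(1)]] z(2) by simp
        hence wj: "w j \<in> L a (Suc i)" using L_antimono[OF a Suc_leI[OF True]] by simp
        have "y \<oplus>\<^bsub>S\<^esub> scal (r i) \<otimes>\<^bsub>S\<^esub> w j \<in> L a (Suc i)"
          using L_add[OF a y(1) L_mult[OF a wj]] r[OF i] scal_closed by blast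
        moreover have "w' i = a [^]\<^bsub>S\<^esub> i \<oplus>\<^bsub>S\<^esub> (y \<oplus>\<^bsub>S\<^esub> scal (r i) \<otimes>\<^bsub>S\<^esub> w j)"
          using True y(2) L_closed[OF a y(1)] L_closed[OF a wj] r[OF i] a
          by (simp add: w'_def S.a_assoc scal_closed)
        ultimately show ?thesis by blast
      qed (use wL i in \<open>simp add: w'_def\<close>)
      \<comment> \<open>The pivot row and column \<open>h\<close> are removed together, which keeps
        more rows than columns.\<close>
      have on_f: "scal f \<otimes>\<^bsub>S\<^esub> a [^]\<^bsub>S\<^esub> N \<in> L a (Suc N)"
      proof (rule insert.IH[of "K - {j}" f w'])
        show "card D < card (K - {j})"
          using cardD j(1) finK by simp
        fix i g assume "i \<in> K - {j}" and g: "g \<in> H - D"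
        hence i: "i \<in> K" "i \<noteq> j" by auto
        note C = wR[of g i] wR[of g j] wR[OF hH i(1)] wR[OF hH j(1)] g i(1) j(1) d(1) e f
        show "f \<otimes>\<^bsub>R\<^esub> coord g (w' i) = \<zero>\<^bsub>R\<^esub>"
        proof (cases "i < j")
          case True
          have w': "coord g (w' i) = coord g (w i) \<oplus>\<^bsub>R\<^esub> r i \<otimes>\<^bsub>R\<^esub> coord g (w j)"
            using True g i j(1) wV r by (simp add: w'_def coord_add coord_scal V_scal)
          have rg: "r i \<otimes>\<^bsub>R\<^esub> coord g (w j)
              = \<ominus>\<^bsub>R\<^esub> (coord h (w i) \<otimes>\<^bsub>R\<^esub> d \<otimes>\<^bsub>R\<^esub> (e \<otimes>\<^bsub>R\<^esub> coord g (w j)))"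
            using C by (simp add: r_def R.l_minus R.m_assoc)
          show ?thesis
          proof (cases "g = h")
            case True
            have "r i \<otimes>\<^bsub>R\<^esub> coord g (w j) = \<ominus>\<^bsub>R\<^esub> (coord h (w i) \<otimes>\<^bsub>R\<^esub> f)"
              unfolding rg using True C c by (simp add: R.m_assoc f_def flip: c_def)
            moreover have "f \<otimes>\<^bsub>R\<^esub> (coord h (w i) \<otimes>\<^bsub>R\<^esub> f) = f \<otimes>\<^bsub>R\<^esub> coord h (w i)"
              using C fcen[of "coord h (w i)"] ff by (metis R.m_assoc)
            ultimately show ?thesis
              unfolding w' using True C by (simp add: R.r_distr R.r_minus R.r_neg)
          next
            case False
            hence "e \<otimes>\<^bsub>R\<^esub> coord g (w j) = \<zero>\<^bsub>R\<^esub>" "e \<otimes>\<^bsub>R\<^esub> coord g (w i) = \<zero>\<^bsub>R\<^esub>"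
              using w0 g i j(1) by auto
            thus ?thesis unfolding w' rg using C f_zero by simp
          qed
        next
          case False
          hence "j < i" using i by simp
          hence "e \<otimes>\<^bsub>R\<^esub> coord g (w i) = \<zero>\<^bsub>R\<^esub>"
            using above[of i] w0[of i g] g i by (cases "g = h") auto
          thus ?thesis using f_zero C False by (simp add: w'_def)
        qed
      qed (use DH insert.prems(2) f ff w'V w'L in auto)
      have "e = e' \<oplus>\<^bsub>R\<^esub> f" using e f by (simp add: e'_def R.minus_eq R.a_assoc R.l_neg)
      hence "scal e \<otimes>\<^bsub>S\<^esub> a [^]\<^bsub>S\<^esub> N
          = scal e' \<otimes>\<^bsub>S\<^esub> a [^]\<^bsub>S\<^esub> N \<oplus>\<^bsub>S\<^esub> scal f \<otimes>\<^bsub>S\<^esub> a [^]\<^bsub>S\<^esub> N"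
        using e' f a by (simp add: scal_add scal_closed S.l_distr)
      thus ?thesis using L_add[OF a on_e' on_f] by simp
    qed
  qed
qed

text \<open>Elimination on the whole of \<open>1\<close>: the \<open>card H + 1\<close> powers of
  \<open>a\<close> with exponents up to \<open>card H\<close> outnumber the columns. Initially each
  row is a pure power, with higher-order term zero.\<close>

lemma left_pi_regular:
  assumes "a \<in> carrier S" "\<And>i :: nat. a [^]\<^bsub>S\<^esub> i \<in> V"
  shows "\<exists>x\<in>carrier S. a [^]\<^bsub>S\<^esub> card H = x \<otimes>\<^bsub>S\<^esub> a [^]\<^bsub>S\<^esub> Suc (card H)"
proof -
  have "scal \<one>\<^bsub>R\<^esub> \<otimes>\<^bsub>S\<^esub> a [^]\<^bsub>S\<^esub> card H \<in> L a (Suc (card H))"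
  proof (rule elimination[where D = H and K = "{..card H}" and w = "\<lambda>i. a [^]\<^bsub>S\<^esub> i"])
    fix i
    have "a [^]\<^bsub>S\<^esub> i = a [^]\<^bsub>S\<^esub> i \<oplus>\<^bsub>S\<^esub> \<zero>\<^bsub>S\<^esub> \<otimes>\<^bsub>S\<^esub> a [^]\<^bsub>S\<^esub> Suc i"
      using assms(1) by simp
    thus "\<exists>y\<in>L a (Suc i). a [^]\<^bsub>S\<^esub> i = a [^]\<^bsub>S\<^esub> i \<oplus>\<^bsub>S\<^esub> y"
      by blast
  qed (use assms finite_H in auto)
  thus ?thesis using assms(1) by (auto simp: scal_one)
qed

end

section \<open>The opposite ring\<close>

definition opposite :: "('a, 'm) ring_scheme \<Rightarrow> ('a, 'm) ring_scheme"
  where "opposite R = R\<lparr>monoid.mult := \<lambda>x y. y \<otimes>\<^bsub>R\<^esub> x\<rparr>"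

lemma opposite_simps [simp]:
  "carrier (opposite R) = carrier R" "x \<otimes>\<^bsub>opposite R\<^esub> y = y \<otimes>\<^bsub>R\<^esub> x"
  "\<one>\<^bsub>opposite R\<^esub> = \<one>\<^bsub>R\<^esub>" "\<zero>\<^bsub>opposite R\<^esub> = \<zero>\<^bsub>R\<^esub>" "x \<oplus>\<^bsub>opposite R\<^esub> y = x \<oplus>\<^bsub>R\<^esub> y"
  by (simp_all add: opposite_def)

lemma (in ring) ring_opposite: "ring (opposite R)"
proof (rule ringI)
  show "abelian_group (opposite R)"
  proof (rule abelian_groupI)
    fix x assume "x \<in> carrier (opposite R)"
    thus "\<exists>y\<in>carrier (opposite R). y \<oplus>\<^bsub>opposite R\<^esub> x = \<zero>\<^bsub>opposite R\<^esub>"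
      by (intro bexI[of _ "\<ominus> x"]) (simp_all add: l_neg)
  qed (simp_all add: a_ac)
  show "monoid (opposite R)"
    by (rule monoidI) (auto simp: m_assoc)
qed (auto simp: l_distr r_distr)

lemma (in ring) nat_pow_opposite:
  assumes "x \<in> carrier R"
  shows "x [^]\<^bsub>opposite R\<^esub> (n::nat) = x [^] n"
proof -
  interpret O: ring "opposite R" by (rule ring_opposite)
  have "x \<otimes> x [^] k = x [^] k \<otimes> x" for k :: nat
    using nat_pow_Suc2[OF assms, of k] by simp
  thus ?thesis using assms by (induction n) simp_all
qed

section \<open>Strongly pi-regular elements\<close>

text \<open>The relation is substituted into itself \<open>k\<close> times. The case
  \<open>k = n\<close> yields \<open>b = x ^ n b ^ 2\<close> for \<open>b = a ^ n\<close>.\<close>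

lemma (in ring) left_pi_regular_iterate:
  assumes "a \<in> carrier R" "x \<in> carrier R" "a [^] n = x \<otimes> a [^] Suc n"
  shows "a [^] n = x [^] k \<otimes> a [^] (n + k)"
proof (induction k)
  case (Suc k)
  have "x [^] Suc k \<otimes> a [^] (n + Suc k) = x [^] k \<otimes> (x \<otimes> a [^] Suc n) \<otimes> a [^] k"
    using assms(1,2) nat_pow_mult[of a "Suc n" k] by (simp add: m_assoc del: nat_pow_Suc)
  also have "\<dots> = x [^] k \<otimes> a [^] (n + k)"
    using assms(1,2) unfolding assms(3)[symmetric] by (simp add: m_assoc nat_pow_mult del: nat_pow_Suc)
  finally show ?case using Suc by simp
qed (use assms(1) in simp)

lemma (in ring) right_pi_regular_iterate:
  assumes "a \<in> carrier R" "x \<in> carrier R" "a [^] n = a [^] Suc n \<otimes> x"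
  shows "a [^] n = a [^] (n + k) \<otimes> x [^] k"
proof -
  interpret O: ring "opposite R" by (rule ring_opposite)
  show ?thesis
    using O.left_pi_regular_iterate[of a x n k] assms
    unfolding opposite_simps nat_pow_opposite[OF assms(1)] nat_pow_opposite[OF assms(2)]
    by blast
qed

text \<open>The unit is \<open>u = z a ^ (n - 1) + (1 - e)\<close>, where \<open>z\<close> is the group inverse of \<open>a ^ n\<close>
  and \<open>e = z a ^ n\<close>; then \<open>u a = e + (1 - e) a\<close>.\<close>

lemma (in ring) strongly_pi_regular_unit_nil_clean:
  assumes a: "a \<in> carrier R" and n: "0 < n"
    and x: "x \<in> carrier R" "a [^] n = x \<otimes> a [^] Suc n"
    and y: "y \<in> carrier R" "a [^] n = a [^] Suc n \<otimes> y"
  shows "\<exists>u\<in>Units R. strongly_nil_clean R (u \<otimes> a)"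
proof -
  define b p q where "b = a [^] n" and "p = x [^] n" and "q = y [^] n"
  have C: "b \<in> carrier R" "p \<in> carrier R" "q \<in> carrier R"
    using a x(1) y(1) by (simp_all add: b_def p_def q_def)
  have bb: "b \<otimes> b = a [^] (n + n)" using a by (simp add: b_def nat_pow_mult)
  have pb: "p \<otimes> (b \<otimes> b) = b"
    unfolding bb unfolding b_def p_def by (rule left_pi_regular_iterate[OF a x, symmetric])
  have bq: "b \<otimes> b \<otimes> q = b"
    unfolding bb unfolding b_def q_def by (rule right_pi_regular_iterate[OF a y, symmetric])
  have ab: "a \<otimes> b = b \<otimes> a"
    using nat_pow_Suc2[OF a, of n] by (simp add: b_def)
  \<comment> \<open>From \<open>b = p b b = b b q\<close>, both \<open>p b\<close> and
    \<open>b q\<close> equal \<open>p b b q\<close>. Hence \<open>e\<close> is a two-sided identity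
    for \<open>b\<close>, and \<open>z\<close> can be written as \<open>e q\<close> or as
    \<open>p e\<close>.\<close>
  define e z where "e = p \<otimes> b" and "z = p \<otimes> b \<otimes> q"
  have Ce: "e \<in> carrier R" and Cz: "z \<in> carrier R" using C by (simp_all add: e_def z_def)
  have e2: "e = b \<otimes> q"
  proof -
    have "e = p \<otimes> (b \<otimes> b \<otimes> q)" using bq by (simp add: e_def)
    also have "\<dots> = p \<otimes> (b \<otimes> b) \<otimes> q" using C by (simp add: m_assoc)
    finally show ?thesis using pb by simp
  qed
  have eb: "e \<otimes> b = b" using pb C by (simp add: e_def m_assoc)
  have be: "b \<otimes> e = b" using bq C by (simp add: e2 m_assoc)
  have ee: "e \<otimes> e = e"
    using C Ce be m_assoc[of p b e] by (simp add: e_def)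
  have z1: "z = e \<otimes> q" by (simp add: z_def e_def)
  have z2: "z = p \<otimes> e" using C by (simp add: z_def e2 m_assoc)
  have zb: "z \<otimes> b = e" using C Ce eb by (simp add: z2 m_assoc e_def)
  have bz: "b \<otimes> z = e" using C Ce be by (simp add: z1 e2 flip: m_assoc)
  have ez: "e \<otimes> z = z" using C Ce ee by (simp add: z1 flip: m_assoc)
  have ze: "z \<otimes> e = z" using C Ce ee by (simp add: z2 m_assoc)
  \<comment> \<open>As \<open>a\<close> commutes with \<open>b\<close>, it commutes with
    \<open>e\<close> and then with \<open>z\<close>: \<open>e\<close> is replaced by
    \<open>b z\<close> or \<open>z b\<close>, and \<open>b\<close> is moved past
    \<open>a\<close>.\<close>
  have "a \<otimes> e = e \<otimes> a \<otimes> e"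
  proof -
    have "a \<otimes> e = b \<otimes> a \<otimes> z" using a C Cz by (simp add: bz[symmetric] ab flip: m_assoc)
    also have "\<dots> = e \<otimes> b \<otimes> a \<otimes> z" by (simp add: eb)
    also have "\<dots> = e \<otimes> (a \<otimes> b) \<otimes> z" using a C Ce by (simp add: ab m_assoc)
    also have "\<dots> = e \<otimes> a \<otimes> e" using a C Ce Cz by (simp add: m_assoc bz)
    finally show ?thesis .
  qed
  moreover have "e \<otimes> a = e \<otimes> a \<otimes> e"
  proof -
    have "e \<otimes> a = z \<otimes> (b \<otimes> a)" using a C Cz by (simp add: zb[symmetric] m_assoc)
    also have "\<dots> = z \<otimes> (a \<otimes> (b \<otimes> e))" by (simp add: be ab)
    also have "\<dots> = z \<otimes> (a \<otimes> b) \<otimes> e" using a C Ce Cz by (simp add: m_assoc)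
    also have "\<dots> = z \<otimes> b \<otimes> a \<otimes> e" using a C Ce Cz by (simp add: ab m_assoc)
    finally show ?thesis by (simp add: zb)
  qed
  ultimately have ae: "a \<otimes> e = e \<otimes> a" by simp
  have az: "a \<otimes> z = z \<otimes> a"
  proof -
    have "z \<otimes> a = z \<otimes> (a \<otimes> e)" using a Ce Cz ze by (simp add: ae flip: m_assoc)
    also have "\<dots> = z \<otimes> (a \<otimes> b) \<otimes> z" using a C Cz by (simp add: bz[symmetric] m_assoc)
    also have "\<dots> = e \<otimes> a \<otimes> z" using a C Cz by (simp add: ab zb flip: m_assoc)
    also have "\<dots> = a \<otimes> z" using a Ce Cz by (simp add: ae[symmetric] m_assoc ez)
    finally show ?thesis by simp
  qed
  obtain m where m: "n = Suc m" using n by (cases n) auto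
  \<comment> \<open>The inverse of \<open>a e\<close> in the corner of \<open>e\<close>; the
    exponent \<open>m = n - 1\<close> requires \<open>n\<close> to be positive.\<close>
  define w where "w = z \<otimes> a [^] m"
  have Cw: "w \<in> carrier R" using Cz a by (simp add: w_def)
  have apow: "a [^] m \<otimes> a = b" "a \<otimes> a [^] m = b"
    using nat_pow_Suc2[OF a, of m] by (simp_all add: b_def m)
  have wa: "w \<otimes> a = e" using Cz a apow zb by (simp add: w_def m_assoc)
  have aw: "a \<otimes> w = e"
  proof -
    have "a \<otimes> w = z \<otimes> (a \<otimes> a [^] m)" using a Cz by (simp add: w_def az flip: m_assoc)
    thus ?thesis by (simp add: apow zb)
  qed
  have ew: "e \<otimes> w = w" using Ce Cz a by (simp add: w_def ez flip: m_assoc)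
  have we: "w \<otimes> e = w"
  proof -
    have "w \<otimes> e = w \<otimes> a \<otimes> w" using Cw a by (simp add: m_assoc aw)
    thus ?thesis by (simp add: wa ew)
  qed
  define f where "f = \<one> \<ominus> e"
  have Cf: "f \<in> carrier R" using Ce by (simp add: f_def)
  have ef: "e \<otimes> f = \<zero>" and fe: "f \<otimes> e = \<zero>" and ff: "f \<otimes> f = f"
    using Ce ee by (simp_all add: f_def minus_eq l_distr r_distr l_minus r_minus r_neg l_neg)
  have e_f: "e \<oplus> f = \<one>"
    using Ce by (metis a_comm a_minus_def a_assoc a_inv_closed f_def l_neg one_closed r_zero)
  have fa: "f \<otimes> a = a \<otimes> f"
    using Ce a by (simp add: f_def minus_eq l_distr r_distr l_minus r_minus ae)
  have wf: "w \<otimes> f = \<zero>" "f \<otimes> w = \<zero>"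
    using Cw Ce Cf we ew ef fe m_assoc[of w e f] m_assoc[of f e w] by simp_all
  have ff': "f \<otimes> (f \<otimes> t) = f \<otimes> t" "e \<otimes> (f \<otimes> t) = \<zero>" "f \<otimes> (e \<otimes> t) = \<zero>"
    if "t \<in> carrier R" for t
    using that Ce Cf by (simp_all add: ff ef fe flip: m_assoc)
  \<comment> \<open>The two are inverse to each other on the corner of \<open>e\<close> and are both
    the identity on that of \<open>f\<close>.\<close>
  define u v where "u = w \<oplus> f" and "v = a \<otimes> e \<oplus> f"
  have Cu: "u \<in> carrier R" "v \<in> carrier R" using Cw Cf Ce a by (simp_all add: u_def v_def)
  have "w \<otimes> (a \<otimes> e) = e" using Cw a Ce wa ee by (simp flip: m_assoc)
  hence uv: "u \<otimes> v = \<one>"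
    using Cw Cf Ce a by (simp add: u_def v_def l_distr r_distr wf ff ff' ae e_f)
  have "a \<otimes> e \<otimes> w = e" using Cw a Ce aw ew by (simp add: m_assoc)
  hence vu: "v \<otimes> u = \<one>"
    using Cw Cf Ce a by (simp add: u_def v_def l_distr r_distr wf ff m_assoc ef e_f)
  have "u \<in> Units R" using uv vu Cu unfolding Units_def by blast
  moreover have "strongly_nil_clean R (u \<otimes> a)"
    unfolding strongly_nil_clean_def
  proof (intro bexI conjI)
    show "u \<otimes> a = e \<oplus> f \<otimes> a" using Cw Cf a by (simp add: u_def l_distr wa)
    show "e \<otimes> (f \<otimes> a) = f \<otimes> a \<otimes> e" using Ce Cf a ff' by (simp add: m_assoc ae)
    \<comment> \<open>The power vanishes because \<open>b = e b\<close> and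
      \<open>f e = 0\<close>.\<close>
    have "(f \<otimes> a) [^] n = f [^] n \<otimes> b"
      unfolding b_def by (rule pow_mult_distrib[OF fa Cf a])
    also have "\<dots> = f [^] n \<otimes> e \<otimes> b" using C Ce Cf by (simp add: m_assoc eb)
    also have "f [^] n = f" unfolding m by (rule pow_idem[OF Cf ff])
    finally have "(f \<otimes> a) [^] n = \<zero>" using C by (simp add: fe)
    thus "f \<otimes> a \<in> nilpotents R" unfolding nilpotents_def using Cf a by blast
  qed (use Ce ee in auto)
  ultimately show ?thesis by blast
qed

section \<open>Group rings\<close>

locale group_ring_data = R: ring R + G: group G
  for R :: "('a, 'm) ring_scheme" and G :: "('g, 'n) monoid_scheme"
begin

sublocale S: ring "group_ring R G"
  by (rule group_ring_ring) (unfold_locales)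

abbreviation "S \<equiv> group_ring R G"

definition const :: "'a \<Rightarrow> 'g \<Rightarrow> 'a"
  where "const r = (\<lambda>g\<in>carrier G. if g = \<one>\<^bsub>G\<^esub> then r else \<zero>\<^bsub>R\<^esub>)"

lemma carrier_iff:
  "f \<in> carrier S \<longleftrightarrow> f \<in> carrier G \<rightarrow>\<^sub>E carrier R \<and> finite {g \<in> carrier G. f g \<noteq> \<zero>\<^bsub>R\<^esub>}"
  by (simp add: group_ring_def)

lemma value_closed: "f \<in> carrier S \<Longrightarrow> g \<in> carrier G \<Longrightarrow> f g \<in> carrier R"
  by (auto simp: carrier_iff)

lemma add_value: "g \<in> carrier G \<Longrightarrow> (f \<oplus>\<^bsub>S\<^esub> h) g = f g \<oplus>\<^bsub>R\<^esub> h g"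
  by (simp add: group_ring_def)

lemma zero_value: "g \<in> carrier G \<Longrightarrow> \<zero>\<^bsub>S\<^esub> g = \<zero>\<^bsub>R\<^esub>"
  by (simp add: group_ring_def)

lemma one_eq_const: "\<one>\<^bsub>S\<^esub> = const \<one>\<^bsub>R\<^esub>"
  by (simp add: group_ring_def const_def)

lemma mult_value:
  "g \<in> carrier G \<Longrightarrow> (f \<otimes>\<^bsub>S\<^esub> h) g =
    (\<Oplus>\<^bsub>R\<^esub>x\<in>{x \<in> carrier G. f x \<noteq> \<zero>\<^bsub>R\<^esub>}. f x \<otimes>\<^bsub>R\<^esub> h (inv\<^bsub>G\<^esub> x \<otimes>\<^bsub>G\<^esub> g))"
  by (simp add: group_ring_def)

lemma group_ring_eqI:
  assumes "f \<in> carrier S" "h \<in> carrier S" "\<And>g. g \<in> carrier G \<Longrightarrow> f g = h g"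
  shows "f = h"
  using assms by (intro PiE_ext[of f "carrier G" "\<lambda>_. carrier R"]) (auto simp: carrier_iff)

lemma const_closed: "r \<in> carrier R \<Longrightarrow> const r \<in> carrier S"
  unfolding carrier_iff
  by (auto simp: const_def intro: finite_subset[of _ "{\<one>\<^bsub>G\<^esub>}"])

lemma const_add:
  "r \<in> carrier R \<Longrightarrow> s \<in> carrier R \<Longrightarrow> const (r \<oplus>\<^bsub>R\<^esub> s) = const r \<oplus>\<^bsub>S\<^esub> const s"
  by (intro group_ring_eqI) (auto simp: const_closed add_value, auto simp: const_def)

lemma const_mult_value:
  assumes r: "r \<in> carrier R" and f: "f \<in> carrier S" and g: "g \<in> carrier G"
  shows "(const r \<otimes>\<^bsub>S\<^esub> f) g = r \<otimes>\<^bsub>R\<^esub> f g"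
proof -
  have "(const r \<otimes>\<^bsub>S\<^esub> f) g
      = (\<Oplus>\<^bsub>R\<^esub>x\<in>{\<one>\<^bsub>G\<^esub>}. const r x \<otimes>\<^bsub>R\<^esub> f (inv\<^bsub>G\<^esub> x \<otimes>\<^bsub>G\<^esub> g))"
    unfolding mult_value[OF g]
    by (rule R.finsum_superset)
      (use r f g in \<open>auto simp: const_def value_closed split: if_splits\<close>)
  thus ?thesis using r g value_closed[OF f g] by (simp add: const_def)
qed

text \<open>In the opposite ring, scalars act by right multiplication with constants; this supplies
  the coordinates there.\<close>

lemma mult_const_value:
  assumes r: "r \<in> carrier R" and f: "f \<in> carrier S" and g: "g \<in> carrier G"
  shows "(f \<otimes>\<^bsub>S\<^esub> const r) g = f g \<otimes>\<^bsub>R\<^esub> r"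
proof -
  let ?A = "{x \<in> carrier G. f x \<noteq> \<zero>\<^bsub>R\<^esub>}"
  have fin: "finite ?A" using f by (simp add: carrier_iff)
  have C: "f x \<otimes>\<^bsub>R\<^esub> const r (inv\<^bsub>G\<^esub> x \<otimes>\<^bsub>G\<^esub> g) \<in> carrier R" if "x \<in> carrier G" for x
    using that r g value_closed[OF f] by (simp add: value_closed[OF const_closed])
  \<comment> \<open>Only the summand at \<open>g\<close> can survive. It is inserted because
    \<open>g\<close> may lie outside the support of \<open>f\<close>.\<close>
  have "(f \<otimes>\<^bsub>S\<^esub> const r) g
      = (\<Oplus>\<^bsub>R\<^esub>x\<in>insert g ?A. f x \<otimes>\<^bsub>R\<^esub> const r (inv\<^bsub>G\<^esub> x \<otimes>\<^bsub>G\<^esub> g))"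
    unfolding mult_value[OF g]
  proof (rule R.finsum_superset)
    fix x assume x: "x \<in> insert g ?A"
    thus "f x \<otimes>\<^bsub>R\<^esub> const r (inv\<^bsub>G\<^esub> x \<otimes>\<^bsub>G\<^esub> g) \<in> carrier R" using C g by blast
    assume "x \<notin> ?A"
    hence "f x = \<zero>\<^bsub>R\<^esub>" using x g by auto
    thus "f x \<otimes>\<^bsub>R\<^esub> const r (inv\<^bsub>G\<^esub> x \<otimes>\<^bsub>G\<^esub> g) = \<zero>\<^bsub>R\<^esub>"
      using x g r by (auto simp: value_closed[OF const_closed])
  qed (use fin in auto)
  also have "\<dots> = (\<Oplus>\<^bsub>R\<^esub>x\<in>insert g ?A. if g = x then f x \<otimes>\<^bsub>R\<^esub> r else \<zero>\<^bsub>R\<^esub>)"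
  proof (rule R.finsum_cong'[OF refl])
    fix x assume "x \<in> insert g ?A"
    hence x: "x \<in> carrier G" using g by auto
    have "inv\<^bsub>G\<^esub> x \<otimes>\<^bsub>G\<^esub> g = \<one>\<^bsub>G\<^esub> \<longleftrightarrow> g = x"
      using G.inv_solve_left'[of "\<one>\<^bsub>G\<^esub>" x g] x g by auto
    thus "f x \<otimes>\<^bsub>R\<^esub> const r (inv\<^bsub>G\<^esub> x \<otimes>\<^bsub>G\<^esub> g) = (if g = x then f x \<otimes>\<^bsub>R\<^esub> r else \<zero>\<^bsub>R\<^esub>)"
      using x g value_closed[OF f x] by (simp add: const_def)
  qed (use value_closed[OF f] g r in auto)
  also have "\<dots> = f g \<otimes>\<^bsub>R\<^esub> r"
    by (rule R.finsum_singleton) (use value_closed[OF f] g fin r in auto)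
  finally show ?thesis .
qed

text \<open>For a subgroup \<open>H\<close> this is the copy of \<open>RH\<close> in
  \<open>RG\<close>. Keeping it inside \<open>RG\<close> avoids a change of ring.\<close>

definition supported :: "'g set \<Rightarrow> ('g \<Rightarrow> 'a) set"
  where "supported H = {f \<in> carrier S. \<forall>g\<in>carrier G - H. f g = \<zero>\<^bsub>R\<^esub>}"

lemma supported_mult:
  assumes H: "subgroup H G" and f: "f \<in> supported H" and h: "h \<in> supported H"
  shows "f \<otimes>\<^bsub>S\<^esub> h \<in> supported H"
proof -
  have "(f \<otimes>\<^bsub>S\<^esub> h) g = \<zero>\<^bsub>R\<^esub>" if g: "g \<in> carrier G - H" for g
  proof -
    have gG: "g \<in> carrier G" using g by simp
    show ?thesis
      unfolding mult_value[OF gG]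
    proof (rule R.add.finprod_one_eqI)
      fix x assume "x \<in> {x \<in> carrier G. f x \<noteq> \<zero>\<^bsub>R\<^esub>}"
      hence x: "x \<in> carrier G" "x \<in> H" using f by (auto simp: supported_def)
      \<comment> \<open>Translation by an element of \<open>H\<close> preserves the complement of
        \<open>H\<close>, where \<open>h\<close> vanishes.\<close>
      have "inv\<^bsub>G\<^esub> x \<otimes>\<^bsub>G\<^esub> g \<notin> H"
      proof
        assume "inv\<^bsub>G\<^esub> x \<otimes>\<^bsub>G\<^esub> g \<in> H"
        hence "x \<otimes>\<^bsub>G\<^esub> (inv\<^bsub>G\<^esub> x \<otimes>\<^bsub>G\<^esub> g) \<in> H" using x subgroup.m_closed[OF H] by blast
        thus False using g x by (simp add: G.m_assoc[symmetric])
      qed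
      hence "h (inv\<^bsub>G\<^esub> x \<otimes>\<^bsub>G\<^esub> g) = \<zero>\<^bsub>R\<^esub>"
        using h x gG by (simp add: supported_def)
      thus "f x \<otimes>\<^bsub>R\<^esub> h (inv\<^bsub>G\<^esub> x \<otimes>\<^bsub>G\<^esub> g) = \<zero>\<^bsub>R\<^esub>"
        using f x by (simp add: supported_def value_closed)
    qed
  qed
  thus ?thesis using f h by (simp add: supported_def)
qed

lemma const_supported:
  assumes "subgroup H G" "r \<in> carrier R"
  shows "const r \<in> supported H"
  using const_closed[OF assms(2)] subgroup.one_closed[OF assms(1)]
  by (auto simp: supported_def) (auto simp: const_def)

lemma supported_pow:
  assumes "subgroup H G" "f \<in> supported H"
  shows "f [^]\<^bsub>S\<^esub> (n::nat) \<in> supported H"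
  using assms by (induction n) (auto simp: one_eq_const const_supported supported_mult)

text \<open>The coordinates are the coefficients at the elements of \<open>H\<close>. Regularity and
  centrality of idempotents are left-right symmetric, so the opposite rings qualify as well.\<close>

lemma group_ring_coordinates:
  assumes regular: "\<And>c. c \<in> carrier R \<Longrightarrow> \<exists>d\<in>carrier R. c = c \<otimes>\<^bsub>R\<^esub> d \<otimes>\<^bsub>R\<^esub> c"
    and central: "\<And>e r. e \<in> carrier R \<Longrightarrow> e \<otimes>\<^bsub>R\<^esub> e = e \<Longrightarrow> r \<in> carrier R \<Longrightarrow>
      e \<otimes>\<^bsub>R\<^esub> r = r \<otimes>\<^bsub>R\<^esub> e"
    and H: "subgroup H G" "finite H"
  shows "regular_coordinates R S const (supported H) H (\<lambda>h f. f h)"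
    and "regular_coordinates (opposite R) (opposite S) const (supported H) H (\<lambda>h f. f h)"
proof -
  interpret RO: ring "opposite R" by (rule R.ring_opposite)
  interpret SO: ring "opposite S" by (rule S.ring_opposite)
  have HG: "g \<in> carrier G" if "g \<in> H" for g using that subgroup.subset[OF H(1)] by blast
  have add: "v \<oplus>\<^bsub>S\<^esub> w \<in> supported H" if "v \<in> supported H" "w \<in> supported H" for v w
    using that by (auto simp: supported_def add_value)
  have sep: "v = \<zero>\<^bsub>S\<^esub>" if "v \<in> supported H" "\<And>h. h \<in> H \<Longrightarrow> v h = \<zero>\<^bsub>R\<^esub>" for v
    using that by (intro group_ring_eqI) (auto simp: supported_def zero_value)
  have sub: "v \<in> carrier S" if "v \<in> supported H" for v
    using that by (simp add: supported_def)
  note facts = HG add sub const_closed const_add one_eq_const supported_mult[OF H(1)]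
    const_supported[OF H(1)] const_mult_value mult_const_value add_value value_closed H(2)
  show "regular_coordinates R S const (supported H) H (\<lambda>h f. f h)"
    by unfold_locales (use regular central in \<open>auto simp: facts intro: sep\<close>)
  show "regular_coordinates (opposite R) (opposite S) const (supported H) H (\<lambda>h f. f h)"
  proof unfold_locales
    fix c assume "c \<in> carrier (opposite R)"
    hence c: "c \<in> carrier R" by simp
    obtain d where d: "d \<in> carrier R" "c = c \<otimes>\<^bsub>R\<^esub> d \<otimes>\<^bsub>R\<^esub> c"
      using regular[OF c] by blast
    have "c = c \<otimes>\<^bsub>R\<^esub> (d \<otimes>\<^bsub>R\<^esub> c)" using R.m_assoc[OF c d(1) c] d(2) by (rule trans[rotated])
    thus "\<exists>d\<in>carrier (opposite R).
        c = c \<otimes>\<^bsub>opposite R\<^esub> d \<otimes>\<^bsub>opposite R\<^esub> c"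
      using d(1) unfolding opposite_simps by blast
  next
    fix e r
    assume "e \<in> carrier (opposite R)" "e \<otimes>\<^bsub>opposite R\<^esub> e = e" "r \<in> carrier (opposite R)"
    thus "e \<otimes>\<^bsub>opposite R\<^esub> r = r \<otimes>\<^bsub>opposite R\<^esub> e"
      using central[of e r] unfolding opposite_simps by simp
  qed (auto simp: facts intro: sep)
qed

end

theorem corollary4p12:
  fixes R :: "('a, 'm) ring_scheme" and G :: "('g, 'n) monoid_scheme"
  assumes "ring R" and "unit_regular R" and "NI_ring R"
    and "group G" and "locally_finite G"
  shows "strongly_unit_nil_clean (group_ring R G)"
  unfolding strongly_unit_nil_clean_def
proof
  interpret R: ring R by fact
  interpret G: group G by fact
  interpret group_ring_data R G by unfold_locales
  fix a assume a: "a \<in> carrier (group_ring R G)"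
  have red: "c = \<zero>\<^bsub>R\<^esub>" if "c \<in> nilpotents R" for c
    using R.regular_NI_imp_reduced[OF assms(3,2) that] .
  have reg: "\<exists>d\<in>carrier R. c = c \<otimes>\<^bsub>R\<^esub> d \<otimes>\<^bsub>R\<^esub> c" if "c \<in> carrier R" for c
    using assms(2) that unfolding unit_regular_def Units_def by blast
  define A where "A = {g \<in> carrier G. a g \<noteq> \<zero>\<^bsub>R\<^esub>}"
  define H where "H = generate G A"
  have H: "subgroup H G"
    unfolding H_def by (rule G.generate_is_subgroup) (simp add: A_def)
  have "finite A" using a by (simp add: A_def carrier_iff)
  hence finH: "finite H"
    using assms(5) unfolding locally_finite_def H_def by (simp add: A_def)
  \<comment> \<open>Even for \<open>a = 0\<close> the subgroup contains the identity, so the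
    exponent \<open>card H\<close> is positive.\<close>
  have cardH: "0 < card H"
    using finH subgroup.one_closed[OF H] by (auto simp: card_gt_0_iff)
  have "a \<in> supported H"
    using a by (auto simp: supported_def H_def A_def intro: generate.incl)
  hence pow: "a [^]\<^bsub>S\<^esub> (i::nat) \<in> supported H" for i
    by (rule supported_pow[OF H])
  note cen = R.reduced_idempotent_central[OF red]
  interpret l: regular_coordinates R S const "supported H" H "\<lambda>h f. f h"
    by (rule group_ring_coordinates(1)[OF reg cen H finH])
  interpret r: regular_coordinates "opposite R" "opposite S" const "supported H" H "\<lambda>h f. f h"
    by (rule group_ring_coordinates(2)[OF reg cen H finH])
  obtain x where x: "x \<in> carrier S" "a [^]\<^bsub>S\<^esub> card H = x \<otimes>\<^bsub>S\<^esub> a [^]\<^bsub>S\<^esub> Suc (card H)"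
    using l.left_pi_regular[OF a pow] by blast
  \<comment> \<open>The left relation in the opposite ring is the right relation here, with the same
    exponent.\<close>
  obtain y where "y \<in> carrier S"
    "a [^]\<^bsub>S\<^esub> card H = a [^]\<^bsub>S\<^esub> Suc (card H) \<otimes>\<^bsub>S\<^esub> y"
    using r.left_pi_regular[of a] a pow
    unfolding opposite_simps S.nat_pow_opposite[OF a] by blast
  from S.strongly_pi_regular_unit_nil_clean[OF a cardH x this]
  show "\<exists>u\<in>Units S. strongly_nil_clean S (u \<otimes>\<^bsub>S\<^esub> a)" .
qed

end
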